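(* Let $\mathbb{K}_1=(G,M,I)$ and $\mathbb{K}_2=(M,B,J)$ be formal contexts and let $\mathbb{K}=(G,M,B,Y)$ be their corresponding triadic context. If there exists $b\in B$ such that $M\times\{b\}\subseteq J$, and $(\emptyset,M)$ is a formal concept of $\mathbb{K}_1$, then the concept lattice of $\mathbb{K}_1$ is isomorphic, as an ordered set, to the ordered set of extents of $\mathbb{K}$.
   Context: A formal context $(G,M,I)$ consists of sets $G$ (objects), $M$ (attributes) and a relation $I\subseteq G\times M$. For $A\subseteq G$, $A'=\{m\in M\mid \forall g\in A:(g,m)\in I\}$; for $D\subseteq M$, $D'=\{g\in G\mid\forall m\in D:(g,m)\in I\}$. A formal concept of $(G,M,I)$ is a pair $(A,D)$ with $A\subseteq G$, $D\subseteq M$, $A'=D$, $D'=A$; $A$ is its extent and $D$ its intent. The concept lattice is the set of all formal concepts ordered by $(A_1,D_1)\le(A_2,D_2)\iff A_1\subseteq A_2$. A triadic context $(G,M,B,Y)$ consists of sets $G,M,B$ and a relation $Y\subseteq G\times M\times B$. A triadic concept is a triple $(X_1,X_2,X_3)$ with $X_1\subseteq G$, $X_2\subseteq M$, $X_3\subseteq B$ and $X_1\times X_2\times X_3\subseteq Y$ such that none of the three components can be enlarged without violating $X_1\times X_2\times X_3\subseteq Y$. $X_1$ is called its extent, $X_2$ its intent, $X_3$ its modus. For triadic concepts put $(P_1,P_2,P_3)\lesssim_1(Q_1,Q_2,Q_3)\iff P_1\subseteq Q_1$ and $(P_1,P_2,P_3)\sim_1(Q_1,Q_2,Q_3)\iff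 P_1=Q_1$. The ordered set of extents of the triadic context is the set of all triadic concepts modulo $\sim_1$, with the order $\le_1$ induced by $\lesssim_1$ (equivalently, the set of extents of triadic concepts ordered by inclusion). The triadic context corresponding to $\mathbb{K}_1=(G,M,I)$ and $\mathbb{K}_2=(M,B,J)$ is $\mathbb{K}=(G,M,B,Y)$ with $(g,m,b)\in Y\iff (g,m)\in I\text{ and }(m,b)\in J$. Two ordered sets $V,W$ are isomorphic if there is a bijection $\varphi:V\to W$ with $x\le y\iff\varphi(x)\le\varphi(y)$ for all $x,y\in V$. *)

theory Defs
  imports Main
begin

definition formal_context :: "'g set \<Rightarrow> 'm set \<Rightarrow> ('g \<times> 'm) set \<Rightarrow> bool" where
  "formal_context G M I \<longleftrightarrow> I \<subseteq> G \<times> M"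

definition common_attributes :: "'m set \<Rightarrow> ('g \<times> 'm) set \<Rightarrow> 'g set \<Rightarrow> 'm set" where
  "common_attributes M I A = {m \<in> M. \<forall>g\<in>A. (g, m) \<in> I}"

definition common_objects :: "'g set \<Rightarrow> ('g \<times> 'm) set \<Rightarrow> 'm set \<Rightarrow> 'g set" where
  "common_objects G I D = {g \<in> G. \<forall>m\<in>D. (g, m) \<in> I}"

definition formal_concepts ::
  "'g set \<Rightarrow> 'm set \<Rightarrow> ('g \<times> 'm) set \<Rightarrow> ('g set \<times> 'm set) set" where
  "formal_concepts G M I =
     {(A, D). A \<subseteq> G \<and> D \<subseteq> M \<and> common_attributes M I A = D \<and> common_objects G I D = A}"

definition concept_le :: "'g set \<times> 'm set \<Rightarrow> 'g set \<times> 'm set \<Rightarrow> bool" where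
  "concept_le P Q \<longleftrightarrow> fst P \<subseteq> fst Q"

definition triadic_context ::
  "'g set \<Rightarrow> 'm set \<Rightarrow> 'b set \<Rightarrow> ('g \<times> 'm \<times> 'b) set \<Rightarrow> bool" where
  "triadic_context G M B Y \<longleftrightarrow> Y \<subseteq> G \<times> M \<times> B"

definition triadic_concepts ::
  "'g set \<Rightarrow> 'm set \<Rightarrow> 'b set \<Rightarrow> ('g \<times> 'm \<times> 'b) set \<Rightarrow> ('g set \<times> 'm set \<times> 'b set) set" where
  "triadic_concepts G M B Y =
     {(X1, X2, X3). X1 \<subseteq> G \<and> X2 \<subseteq> M \<and> X3 \<subseteq> B \<and> X1 \<times> X2 \<times> X3 \<subseteq> Y \<and>
        \<not> (\<exists>Z. X1 \<subset> Z \<and> Z \<subseteq> G \<and> Z \<times> X2 \<times> X3 \<subseteq> Y) \<and>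
        \<not> (\<exists>Z. X2 \<subset> Z \<and> Z \<subseteq> M \<and> X1 \<times> Z \<times> X3 \<subseteq> Y) \<and>
        \<not> (\<exists>Z. X3 \<subset> Z \<and> Z \<subseteq> B \<and> X1 \<times> X2 \<times> Z \<subseteq> Y)}"

definition extent_preorder ::
  "'g set \<times> 'm set \<times> 'b set \<Rightarrow> 'g set \<times> 'm set \<times> 'b set \<Rightarrow> bool" where
  "extent_preorder P Q \<longleftrightarrow> fst P \<subseteq> fst Q"

definition extent_equiv ::
  "'g set \<Rightarrow> 'm set \<Rightarrow> 'b set \<Rightarrow> ('g \<times> 'm \<times> 'b) set \<Rightarrow>
     (('g set \<times> 'm set \<times> 'b set) \<times> ('g set \<times> 'm set \<times> 'b set)) set" where
  "extent_equiv G M B Y =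
     {(P, Q) \<in> triadic_concepts G M B Y \<times> triadic_concepts G M B Y. fst P = fst Q}"

definition triadic_extents ::
  "'g set \<Rightarrow> 'm set \<Rightarrow> 'b set \<Rightarrow> ('g \<times> 'm \<times> 'b) set \<Rightarrow>
     ('g set \<times> 'm set \<times> 'b set) set set" where
  "triadic_extents G M B Y = triadic_concepts G M B Y // extent_equiv G M B Y"

definition triadic_extent_le ::
  "('g set \<times> 'm set \<times> 'b set) set \<Rightarrow> ('g set \<times> 'm set \<times> 'b set) set \<Rightarrow> bool" where
  "triadic_extent_le U V \<longleftrightarrow> (\<exists>P\<in>U. \<exists>Q\<in>V. extent_preorder P Q)"

definition corresponding_incidence ::
  "('g \<times> 'm) set \<Rightarrow> ('m \<times> 'b) set \<Rightarrow> ('g \<times> 'm \<times> 'b) set" where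
  "corresponding_incidence I J = {(g, m, b). (g, m) \<in> I \<and> (m, b) \<in> J}"

definition order_isomorphic ::
  "'v set \<Rightarrow> ('v \<Rightarrow> 'v \<Rightarrow> bool) \<Rightarrow> 'w set \<Rightarrow> ('w \<Rightarrow> 'w \<Rightarrow> bool) \<Rightarrow> bool" where
  "order_isomorphic V le_V W le_W \<longleftrightarrow>
     (\<exists>\<phi>. bij_betw \<phi> V W \<and> (\<forall>x\<in>V. \<forall>y\<in>V. le_V x y \<longleftrightarrow> le_W (\<phi> x) (\<phi> y)))"

lemma triadic_context_corresponding:
  assumes "formal_context G M I" and "formal_context M B J"
  shows "triadic_context G M B (corresponding_incidence I J)"
  using assms
  by (auto simp: formal_context_def triadic_context_def corresponding_incidence_def)

lemma equiv_extent_equiv: "equiv (triadic_concepts G M B Y) (extent_equiv G M B Y)"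
  by (rule equivI) (auto simp: extent_equiv_def refl_on_def sym_def trans_def)

(* The induced order does not depend on the chosen representatives. *)
lemma triadic_extent_le_class_iff:
  assumes "P \<in> triadic_concepts G M B Y" and "Q \<in> triadic_concepts G M B Y"
  shows "triadic_extent_le (extent_equiv G M B Y `` {P}) (extent_equiv G M B Y `` {Q})
           \<longleftrightarrow> fst P \<subseteq> fst Q"
  using assms
  by (fastforce simp: triadic_extent_le_def extent_preorder_def extent_equiv_def Bex_def
      simp del: split_paired_Ex)

end

theory Submission
  imports Defs
begin

text \<open>
  The point is that the two structures have the same extents. Both orders are inclusion of extents,
  a formal concept is determined by its extent, and a class of triadic concepts modulo
  \<open>\<sim>\<^sub>1\<close> is by construction determined by its common extent; so sending a formal concept to the class
  of triadic concepts with the same extent is an isomorphism as soon as the two sets of extents agree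
  (lemma \<open>order_isomorphic_if_extents_eq\<close>).

  From triadic to dyadic: in a triadic concept \<open>(X\<^sub>1, X\<^sub>2, X\<^sub>3)\<close> with no empty component, the condition
  \<open>X\<^sub>1 \<times> X\<^sub>2 \<times> X\<^sub>3 \<subseteq> Y\<close> splits into \<open>X\<^sub>1 \<times> X\<^sub>2 \<subseteq> I\<close> and \<open>X\<^sub>2 \<times> X\<^sub>3 \<subseteq> J\<close>, of which only the first constrains
  \<open>X\<^sub>1\<close>. Maximality of \<open>X\<^sub>1\<close> then says that \<open>X\<^sub>1\<close> is the derivation \<open>X\<^sub>2'\<close>, hence an extent. If \<open>X\<^sub>2\<close> or
  \<open>X\<^sub>3\<close> is empty, then \<open>X\<^sub>1 = G\<close>, and \<open>G\<close> is the derivation of the empty set. The remaining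
  possibility \<open>X\<^sub>1 = {}\<close> is where the concept \<open>({}, M)\<close> enters (lemma \<open>triadic_extent_is_extent\<close>).

  From dyadic to triadic: a formal concept \<open>(A, D)\<close> is completed by the largest modus compatible with
  \<open>D\<close>, the derivation of \<open>D\<close> in the second context. A condition \<open>b\<close> related to every
  attribute lies in this modus whatever \<open>D\<close> is, so the modus is nonempty and the triadic maximality
  of \<open>A\<close> and \<open>D\<close> reduces to the dyadic one; the modus itself is maximal because some object lies in
  \<open>A\<close>. For \<open>A = {}\<close> the triple \<open>({}, M, B)\<close> serves instead, and its extent cannot grow because no
  object has all attributes (lemma \<open>extent_is_triadic_extent\<close>).
\<close>

lemma formal_concept_eq_if_extent_eq:
  assumes "P \<in> formal_concepts G M I" and "Q \<in> formal_concepts G M I" and "fst P = fst Q"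
  shows "P = Q"
  using assms by (auto simp: formal_concepts_def)

lemma order_isomorphic_if_extents_eq:
  assumes eq: "fst ` formal_concepts G M I = fst ` triadic_concepts G M B Y"
  shows "order_isomorphic (formal_concepts G M I) concept_le
           (triadic_extents G M B Y) triadic_extent_le"
proof -
  let ?T = "triadic_concepts G M B Y" and ?E = "extent_equiv G M B Y"
  from eq have "\<forall>P\<in>formal_concepts G M I. \<exists>T. T \<in> ?T \<and> fst T = fst P"
    by (metis imageE imageI)
  then obtain t where t: "t P \<in> ?T" "fst (t P) = fst P" if "P \<in> formal_concepts G M I" for P
    by metis
  let ?f = "\<lambda>P. ?E `` {t P}"
  have le: "concept_le P Q \<longleftrightarrow> triadic_extent_le (?f P) (?f Q)"
    if "P \<in> formal_concepts G M I" "Q \<in> formal_concepts G M I" for P Q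
    using t[OF that(1)] t[OF that(2)]
    by (simp add: triadic_extent_le_class_iff concept_le_def)
  \<comment> \<open>Elements with equal images lie below each other, and \<open>concept_le\<close> is antisymmetric on concepts.\<close>
  have inj: "inj_on ?f (formal_concepts G M I)"
  proof (rule inj_onI)
    fix P Q
    assume P: "P \<in> formal_concepts G M I" and Q: "Q \<in> formal_concepts G M I" and "?f P = ?f Q"
    then have "concept_le P Q" "concept_le Q P"
      using le[OF P P] le[OF P Q] le[OF Q P] by (simp_all add: concept_le_def)
    with P Q show "P = Q"
      by (intro formal_concept_eq_if_extent_eq) (auto simp: concept_le_def)
  qed
  have surj: "?f ` formal_concepts G M I = triadic_extents G M B Y"
  proof
    show "?f ` formal_concepts G M I \<subseteq> triadic_extents G M B Y"
      using t(1) by (auto simp: triadic_extents_def intro!: quotientI)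
  next
    show "triadic_extents G M B Y \<subseteq> ?f ` formal_concepts G M I"
    proof
      fix U assume "U \<in> triadic_extents G M B Y"
      then obtain T where T: "T \<in> ?T" and U: "U = ?E `` {T}"
        unfolding triadic_extents_def by (rule quotientE)
      from T eq obtain P where P: "P \<in> formal_concepts G M I" "fst P = fst T"
        by (metis imageE imageI)
      with t[OF P(1)] T have "(t P, T) \<in> ?E"
        by (simp add: extent_equiv_def)
      then have "?f P = U"
        unfolding U by (rule equiv_class_eq[OF equiv_extent_equiv])
      with P(1) show "U \<in> ?f ` formal_concepts G M I"
        by blast
    qed
  qed
  from inj surj le show ?thesis
    unfolding order_isomorphic_def bij_betw_def by blast
qed

lemma triadic_conceptI:
  assumes "X1 \<subseteq> G" "X2 \<subseteq> M" "X3 \<subseteq> B" "X1 \<times> X2 \<times> X3 \<subseteq> Y"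
    and "\<And>Z. Z \<subseteq> G \<Longrightarrow> Z \<times> X2 \<times> X3 \<subseteq> Y \<Longrightarrow> Z \<subseteq> X1"
    and "\<And>Z. Z \<subseteq> M \<Longrightarrow> X1 \<times> Z \<times> X3 \<subseteq> Y \<Longrightarrow> Z \<subseteq> X2"
    and "\<And>Z. Z \<subseteq> B \<Longrightarrow> X1 \<times> X2 \<times> Z \<subseteq> Y \<Longrightarrow> Z \<subseteq> X3"
  shows "(X1, X2, X3) \<in> triadic_concepts G M B Y"
proof -
  have "\<not> (\<exists>Z. X1 \<subset> Z \<and> Z \<subseteq> G \<and> Z \<times> X2 \<times> X3 \<subseteq> Y)"
    using assms(5) by (meson less_le_not_le)
  moreover have "\<not> (\<exists>Z. X2 \<subset> Z \<and> Z \<subseteq> M \<and> X1 \<times> Z \<times> X3 \<subseteq> Y)"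
    using assms(6) by (meson less_le_not_le)
  moreover have "\<not> (\<exists>Z. X3 \<subset> Z \<and> Z \<subseteq> B \<and> X1 \<times> X2 \<times> Z \<subseteq> Y)"
    using assms(7) by (meson less_le_not_le)
  ultimately show ?thesis
    using assms(1-4) unfolding triadic_concepts_def mem_Collect_eq prod.case by (intro conjI)
qed

text \<open>Derivation is a Galois connection, so deriving three times is the same as deriving once.\<close>

lemma common_objects_is_extent:
  assumes "D \<subseteq> M"
  shows "common_objects G I D \<in> fst ` formal_concepts G M I"
proof -
  let ?A = "common_objects G I D"
  have "(?A, common_attributes M I ?A) \<in> formal_concepts G M I"
    using assms by (auto simp: formal_concepts_def common_objects_def common_attributes_def)
  then show ?thesis
    by force
qed

lemma triadic_extent_is_extent:
  assumes X: "(X1, X2, X3) \<in> triadic_concepts G M B (corresponding_incidence I J)"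
    and empty: "{} \<in> fst ` formal_concepts G M I"
  shows "X1 \<in> fst ` formal_concepts G M I"
proof (cases "X1 = {}")
  case False
  let ?Y = "corresponding_incidence I J"
  from X have sub: "X1 \<subseteq> G" "X2 \<subseteq> M" "X1 \<times> X2 \<times> X3 \<subseteq> ?Y"
    and maximal: "\<not> (\<exists>Z. X1 \<subset> Z \<and> Z \<subseteq> G \<and> Z \<times> X2 \<times> X3 \<subseteq> ?Y)"
    unfolding triadic_concepts_def by simp_all
  have max: "Z = X1" if "X1 \<subseteq> Z" "Z \<subseteq> G" "Z \<times> X2 \<times> X3 \<subseteq> ?Y" for Z
    using maximal that by (metis psubsetI)
  show ?thesis
  proof (cases "X2 = {} \<or> X3 = {}")
    case True
    then have "X1 = G"
      using max[of G] sub(1) by auto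
    then have "X1 = common_objects G I {}"
      by (simp add: common_objects_def)
    then show ?thesis
      using common_objects_is_extent[of "{}" M G I] by simp
  next
    case nonempty: False
    have "X1 \<subseteq> common_objects G I X2"
      using sub nonempty by (fastforce simp: common_objects_def corresponding_incidence_def)
    moreover
    \<comment> \<open>A witness in \<open>X1\<close> is what frees the \<open>J\<close>-part of the incidence from the object.\<close>
    have "X2 \<times> X3 \<subseteq> J"
      using sub(3) False by (fastforce simp: corresponding_incidence_def)
    then have "common_objects G I X2 \<times> X2 \<times> X3 \<subseteq> ?Y"
      by (auto simp: common_objects_def corresponding_incidence_def)
    moreover have "common_objects G I X2 \<subseteq> G"
      by (auto simp: common_objects_def)
    ultimately have "common_objects G I X2 = X1"
      by (intro max)
    with common_objects_is_extent[OF sub(2), of G I] show ?thesis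
      by simp
  qed
qed (use empty in simp)

text \<open>
  The empty extent needs a modus of its own: a product with an empty factor imposes no condition, so a
  triple with extent \<open>{}\<close> is maximal only if intent and modus are all of \<open>M\<close> and \<open>B\<close>.
\<close>

lemma extent_is_triadic_extent:
  assumes AD: "(A, D) \<in> formal_concepts G M I"
    and b: "b \<in> B" "M \<times> {b} \<subseteq> J"
    and empty: "({}, M) \<in> formal_concepts G M I"
  shows "A \<in> fst ` triadic_concepts G M B (corresponding_incidence I J)"
proof (cases "A = {}")
  case True
  let ?Y = "corresponding_incidence I J"
  have extent_max: "Z = {}" if "Z \<subseteq> G" "Z \<times> M \<times> B \<subseteq> ?Y" for Z
  proof -
    have "Z \<subseteq> common_objects G I M"
      using that b(1) by (fastforce simp: common_objects_def corresponding_incidence_def)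
    with empty show ?thesis
      by (auto simp: formal_concepts_def)
  qed
  have "({}, M, B) \<in> triadic_concepts G M B ?Y"
    by (rule triadic_conceptI) (use extent_max in simp_all)
  with True show ?thesis
    by force
next
  case False
  let ?Y = "corresponding_incidence I J"
  let ?C = "common_attributes B J D"
  from AD have sub: "A \<subseteq> G" "D \<subseteq> M"
    and der: "common_attributes M I A = D" "common_objects G I D = A"
    by (auto simp: formal_concepts_def)
  have bC: "b \<in> ?C"
    using b sub(2) by (auto simp: common_attributes_def)
  have inY: "A \<times> D \<times> ?C \<subseteq> ?Y"
    using der(1) by (auto simp: common_attributes_def corresponding_incidence_def)
  have extent_max: "Z \<subseteq> A" if "Z \<subseteq> G" "Z \<times> D \<times> ?C \<subseteq> ?Y" for Z
  proof -
    have "Z \<subseteq> common_objects G I D"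
      using that bC by (fastforce simp: common_objects_def corresponding_incidence_def)
    with der(2) show ?thesis
      by simp
  qed
  have intent_max: "Z \<subseteq> D" if "Z \<subseteq> M" "A \<times> Z \<times> ?C \<subseteq> ?Y" for Z
  proof -
    have "(g, m) \<in> I" if "g \<in> A" "m \<in> Z" for g m
      using \<open>A \<times> Z \<times> ?C \<subseteq> ?Y\<close> that bC by (auto simp: corresponding_incidence_def)
    with \<open>Z \<subseteq> M\<close> have "Z \<subseteq> common_attributes M I A"
      by (auto simp: common_attributes_def)
    with der(1) show ?thesis
      by simp
  qed
  have modus_max: "Z \<subseteq> ?C" if "Z \<subseteq> B" "A \<times> D \<times> Z \<subseteq> ?Y" for Z
    using that False by (fastforce simp: common_attributes_def corresponding_incidence_def)
  have "?C \<subseteq> B"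
    by (auto simp: common_attributes_def)
  with sub inY have "(A, D, ?C) \<in> triadic_concepts G M B ?Y"
    by (intro triadic_conceptI extent_max intent_max modus_max)
  then show ?thesis
    by force
qed

theorem lemma5:
  fixes G :: "'g set" and M :: "'m set" and B :: "'b set"
    and I :: "('g \<times> 'm) set" and J :: "('m \<times> 'b) set"
  assumes "formal_context G M I" and "formal_context M B J"
    and "\<exists>b\<in>B. M \<times> {b} \<subseteq> J"
    and "({}, M) \<in> formal_concepts G M I"
  shows "order_isomorphic (formal_concepts G M I) concept_le
           (triadic_extents G M B (corresponding_incidence I J)) triadic_extent_le"
proof (rule order_isomorphic_if_extents_eq, rule equalityI)
  from assms(3) obtain b where b: "b \<in> B" "M \<times> {b} \<subseteq> J"
    by blast
  show "fst ` formal_concepts G M I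
      \<subseteq> fst ` triadic_concepts G M B (corresponding_incidence I J)"
    by (rule image_subsetI) (metis extent_is_triadic_extent[OF _ b assms(4)] prod.collapse)
  have empty: "{} \<in> fst ` formal_concepts G M I"
    using image_eqI[OF _ assms(4), of "{}" fst] by simp
  show "fst ` triadic_concepts G M B (corresponding_incidence I J)
      \<subseteq> fst ` formal_concepts G M I"
  proof (rule image_subsetI)
    fix T assume "T \<in> triadic_concepts G M B (corresponding_incidence I J)"
    then show "fst T \<in> fst ` formal_concepts G M I"
      by (cases T) (simp only: fst_conv triadic_extent_is_extent[OF _ empty])
  qed
qed

end
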